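(* Assume $n=\Omega(\epsilon^{-2})$. Let $S$ be a real matrix with $n$ columns. If, in the turnstile model (i.e. for arbitrary $x\in\mathbb{R}^n$), some algorithm, given $Sx$, never fails in returning a set of size $\mathcal{O}(1/\epsilon)$ containing all the $\epsilon$-heavy hitters of $x$ (it need not return approximations of their values), then $S$ has $\Omega(\epsilon^{-2})$ rows.
   Context: Heavy hitters are with respect to the $\ell_1$ norm: $x_i$ is an $\epsilon$-heavy hitter if $|x_i|\geq\epsilon\|x\|_1$. In the turnstile model no sign constraint is imposed on the coordinates of $x$. *)

theory Defs
  imports "Jordan_Normal_Form.Matrix"
begin

definition l1_norm :: "real vec \<Rightarrow> real" where
  "l1_norm x = (\<Sum>i<dim_vec x. \<bar>x $ i\<bar>)"

definition heavy_hitters :: "real \<Rightarrow> real vec \<Rightarrow> nat set" where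
  "heavy_hitters \<epsilon> x = {i. i < dim_vec x \<and> \<bar>x $ i\<bar> \<ge> \<epsilon> * l1_norm x}"

text \<open>
  The zero vector is exempt from the containment requirement: by the literal inequality every
  coordinate of \<open>0\<close> is a heavy hitter, so without the exemption no algorithm returning fewer than
  \<open>n\<close> indices could be correct, whatever \<open>S\<close> is.
  An algorithm is an arbitrary function of the sketch \<open>S x\<close>; it may depend on \<open>S\<close> and \<open>\<epsilon>\<close>.
\<close>
definition finds_heavy_hitters ::
  "real \<Rightarrow> real \<Rightarrow> real mat \<Rightarrow> (real vec \<Rightarrow> nat set) \<Rightarrow> bool" where
  "finds_heavy_hitters \<epsilon> k S alg \<longleftrightarrow>
     (\<forall>x \<in> carrier_vec (dim_col S).
        alg (S *\<^sub>v x) \<subseteq> {..<dim_col S} \<and>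
        real (card (alg (S *\<^sub>v x))) \<le> k \<and>
        (x \<noteq> 0\<^sub>v (dim_col S) \<longrightarrow> heavy_hitters \<epsilon> x \<subseteq> alg (S *\<^sub>v x)))"

end

theory Submission
  imports Defs "HOL-Analysis.Convex"
begin

text \<open>
  Every kernel vector of \<open>S\<close> has the same sketch as \<open>0\<close>, so one set \<open>A\<close> of \<open>C/\<epsilon>\<close> indices contains
  the heavy hitters of all of them. Take \<open>T\<close> to be about \<open>c\<^sub>0/\<epsilon>\<^sup>2\<close> indices outside \<open>A\<close>, with
  \<open>c\<^sub>0 \<le> 1/2\<close>. A kernel vector \<open>y\<close> supported on \<open>T\<close> has no heavy hitters in \<open>T\<close>, hence by Cauchy-Schwarz
  \<open>y\<^sub>i\<^sup>2 \<le> \<epsilon>\<^sup>2 |T| \<cdot> \<parallel>y\<parallel>\<^sub>2\<^sup>2 \<le> \<parallel>y\<parallel>\<^sub>2\<^sup>2 / 2\<close>. Applied to the projection of \<open>e\<^sub>i\<close> onto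
  the space of such \<open>y\<close>, this bounds the \<open>i\<close>-th diagonal entry of the projection by \<open>1/2\<close>. Its trace
  is the dimension of that space, which is at least \<open>|T| - m\<close>, so \<open>|T| - m \<le> |T| / 2\<close>.
\<close>

text \<open>Gaussian elimination, one equation per induction step: a pivot unknown of the last
  equation is eliminated from the others, and its value is recovered by back substitution.\<close>

lemma homogeneous_system_nontrivial_solution:
  fixes a :: "nat \<Rightarrow> 'i \<Rightarrow> 'a::field"
  assumes "finite T" "r < card T"
  shows "\<exists>y. (\<exists>i\<in>T. y i \<noteq> 0) \<and> (\<forall>k<r. (\<Sum>i\<in>T. a k i * y i) = 0)"
  using assms
proof (induction r arbitrary: T a)
  case 0
  then obtain i where "i \<in> T" by fastforce
  then show ?case by (intro exI[of _ "\<lambda>_. 1"]) auto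
next
  case (Suc r)
  show ?case
  proof (cases "\<forall>i\<in>T. a r i = 0")
    case True
    obtain y where y: "\<exists>i\<in>T. y i \<noteq> 0" "\<forall>k<r. (\<Sum>i\<in>T. a k i * y i) = 0"
      using Suc.IH[of T a] Suc.prems by auto
    have "(\<Sum>i\<in>T. a r i * y i) = 0"
      using True by (intro sum.neutral) auto
    then show ?thesis
      using y by (auto simp: less_Suc_eq)
  next
    case False
    then obtain p where p: "p \<in> T" "a r p \<noteq> 0" by blast
    define T' where "T' = T - {p}"
    have T': "finite T'" "p \<notin> T'" "T = insert p T'" "r < card T'"
      using Suc.prems p by (auto simp: T'_def card_Diff_singleton)
    \<comment> \<open>Coefficients after solving equation \<open>r\<close> for unknown
      \<open>p\<close> and substituting into equation \<open>k\<close>.\<close>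
    define b where "b k i = a k i - a k p * a r i / a r p" for k i
    obtain z where z: "\<exists>i\<in>T'. z i \<noteq> 0" "\<forall>k<r. (\<Sum>i\<in>T'. b k i * z i) = 0"
      using Suc.IH[of T' b] T' by auto
    define s where "s = (\<Sum>i\<in>T'. a r i * z i)"
    define y where "y = z(p := - s / a r p)"
    have sum_y: "(\<Sum>i\<in>T. a k i * y i) = a k p * (- s / a r p) + (\<Sum>i\<in>T'. a k i * z i)" for k
    proof -
      have "(\<Sum>i\<in>T'. a k i * y i) = (\<Sum>i\<in>T'. a k i * z i)"
        using T'(2) by (intro sum.cong) (auto simp: y_def)
      then show ?thesis
        using T' by (simp add: y_def)
    qed
    have sum_b: "(\<Sum>i\<in>T'. b k i * z i) = (\<Sum>i\<in>T'. a k i * z i) - a k p / a r p * s" for k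
      by (simp add: b_def s_def sum_distrib_left left_diff_distrib sum_subtractf mult.assoc
          times_divide_eq_left)
    have "(\<Sum>i\<in>T. a k i * y i) = 0" if "k < Suc r" for k
    proof (cases "k = r")
      case True
      then show ?thesis using p by (simp add: sum_y s_def)
    next
      case False
      then have "(\<Sum>i\<in>T'. b k i * z i) = 0" using that z by simp
      then show ?thesis by (simp add: sum_y sum_b)
    qed
    moreover have "\<exists>i\<in>T. y i \<noteq> 0"
      using z(1) T' by (auto simp: y_def)
    ultimately show ?thesis by blast
  qed
qed

text \<open>Orthogonality to the vectors already found is just further linear equations, so each new
  vector solves a homogeneous system that still has fewer equations than unknowns; then it is
  normalised.\<close>

lemma kernel_orthonormal_family:
  fixes a :: "nat \<Rightarrow> 'i \<Rightarrow> real"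
  assumes "finite T" "d + m \<le> card T"
  shows "\<exists>u. (\<forall>k<d. \<forall>j<m. (\<Sum>i\<in>T. a j i * u k i) = 0) \<and>
             (\<forall>k<d. \<forall>l<d. (\<Sum>i\<in>T. u k i * u l i) = (if k = l then 1 else 0))"
  using assms(2)
proof (induction d)
  case 0
  then show ?case by simp
next
  case (Suc d)
  then obtain u where u: "\<forall>k<d. \<forall>j<m. (\<Sum>i\<in>T. a j i * u k i) = 0"
      "\<forall>k<d. \<forall>l<d. (\<Sum>i\<in>T. u k i * u l i) = (if k = l then 1 else 0)"
    by auto
  \<comment> \<open>Equations below \<open>m\<close> put \<open>y\<close> in the kernel; the
    remaining \<open>d\<close> make it orthogonal to the earlier vectors.\<close>
  obtain y where y: "\<exists>i\<in>T. y i \<noteq> 0"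
      "\<forall>k<m + d. (\<Sum>i\<in>T. (if k < m then a k i else u (k - m) i) * y i) = 0"
    using homogeneous_system_nontrivial_solution[of T "m + d"
        "\<lambda>k i. if k < m then a k i else u (k - m) i"] assms(1) Suc.prems by auto
  have ya: "(\<Sum>i\<in>T. a j i * y i) = 0" if "j < m" for j
    using y(2)[rule_format, of j] that by simp
  have yu: "(\<Sum>i\<in>T. u k i * y i) = 0" if "k < d" for k
    using y(2)[rule_format, of "m + k"] that by simp
  define s where "s = (\<Sum>i\<in>T. (y i)\<^sup>2)"
  have "s > 0"
    using y(1) assms(1) unfolding s_def by (auto intro: sum_pos2)
  define v where "v i = y i / sqrt s" for i
  have lin: "(\<Sum>i\<in>T. f i * v i) = (\<Sum>i\<in>T. f i * y i) / sqrt s" for f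
    by (simp add: v_def sum_divide_distrib)
  have "(\<Sum>i\<in>T. v i * v i) = (\<Sum>i\<in>T. (y i)\<^sup>2 / s)"
    using \<open>s > 0\<close> by (intro sum.cong) (auto simp: v_def power2_eq_square)
  also have "\<dots> = 1"
    using \<open>s > 0\<close> by (simp add: s_def flip: sum_divide_distrib)
  finally have vv: "(\<Sum>i\<in>T. v i * v i) = 1" .
  have uv: "(\<Sum>i\<in>T. u k i * v i) = 0" "(\<Sum>i\<in>T. v i * u k i) = 0" if "k < d" for k
    using yu[OF that] lin[of "u k"] by (simp_all add: mult.commute)
  show ?case
    using u vv uv ya lin by (intro exI[of _ "u(d := v)"]) (auto simp: less_Suc_eq)
qed

text \<open>The trace argument: projecting onto the span of \<open>card T - m\<close> orthonormal
  kernel vectors gives a matrix whose diagonal entries are at most \<open>B\<close> and whose trace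
  is the dimension of the span.\<close>

lemma kernel_spread_bound:
  fixes a :: "nat \<Rightarrow> 'i \<Rightarrow> real"
  assumes T: "finite T" and "B \<ge> 0"
    and spread: "\<And>y i. \<lbrakk>\<And>j. j < m \<Longrightarrow> (\<Sum>i\<in>T. a j i * y i) = 0; i \<in> T\<rbrakk>
                   \<Longrightarrow> (y i)\<^sup>2 \<le> B * (\<Sum>i\<in>T. (y i)\<^sup>2)"
  shows "real (card T) - real m \<le> B * real (card T)"
proof (cases "m \<le> card T")
  case False
  then show ?thesis using \<open>B \<ge> 0\<close>
    by (smt (verit) mult_nonneg_nonneg of_nat_0_le_iff of_nat_mono nat_le_linear)
next
  case True
  define d where "d = card T - m"
  obtain u where ker: "\<forall>k<d. \<forall>j<m. (\<Sum>i\<in>T. a j i * u k i) = 0"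
    and orth: "\<forall>k<d. \<forall>l<d. (\<Sum>i\<in>T. u k i * u l i) = (if k = l then 1 else 0)"
    using kernel_orthonormal_family[OF T, of d m a] True by (auto simp: d_def)
  have diag: "(\<Sum>k<d. (u k i)\<^sup>2) \<le> B" if i: "i \<in> T" for i
  proof -
    \<comment> \<open>\<open>y\<close> is the projection of the \<open>i\<close>-th unit vector onto
      the span of the \<open>u k\<close>. Its \<open>i\<close>-th entry and its squared norm both
      equal \<open>q\<close>, so the spread hypothesis reads
      \<open>q * q \<le> B * q\<close>.\<close>
    define y where "y t = (\<Sum>k<d. u k i * u k t)" for t
    define q where "q = (\<Sum>k<d. (u k i)\<^sup>2)"
    have "(\<Sum>t\<in>T. a j t * y t) = 0" if "j < m" for j
    proof -
      have "(\<Sum>t\<in>T. a j t * y t) = (\<Sum>k<d. u k i * (\<Sum>t\<in>T. a j t * u k t))"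
        unfolding y_def sum_distrib_left by (subst sum.swap) (simp add: mult_ac)
      then show ?thesis using ker that by simp
    qed
    from spread[OF this i] have "(y i)\<^sup>2 \<le> B * (\<Sum>t\<in>T. (y t)\<^sup>2)" .
    moreover have "y i = q"
      by (simp add: y_def q_def power2_eq_square)
    moreover have "(\<Sum>t\<in>T. (y t)\<^sup>2) = q"
    proof -
      have "(\<Sum>t\<in>T. (y t)\<^sup>2) = (\<Sum>t\<in>T. \<Sum>k<d. \<Sum>l<d. u k i * u l i * (u k t * u l t))"
        by (simp add: y_def power2_eq_square sum_product mult_ac)
      also have "\<dots> = (\<Sum>k<d. \<Sum>l<d. u k i * u l i * (\<Sum>t\<in>T. u k t * u l t))"
        by (subst sum.swap, intro sum.cong refl, subst sum.swap) (simp add: sum_distrib_left)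
      also have "\<dots> = (\<Sum>k<d. \<Sum>l<d. if k = l then u k i * u l i else 0)"
        using orth by (intro sum.cong refl) auto
      also have "\<dots> = q"
        by (simp add: q_def power2_eq_square)
      finally show ?thesis .
    qed
    ultimately have "q * q \<le> B * q" by (simp add: power2_eq_square)
    moreover have "q \<ge> 0" by (simp add: q_def sum_nonneg)
    ultimately have "q \<le> B"
      using \<open>B \<ge> 0\<close> by (cases "q = 0") auto
    then show ?thesis by (simp add: q_def)
  qed
  \<comment> \<open>The trace, summed once by vectors and once by coordinates.\<close>
  have "real d = (\<Sum>k<d. \<Sum>i\<in>T. (u k i)\<^sup>2)"
    using orth by (simp add: power2_eq_square)
  also have "\<dots> = (\<Sum>i\<in>T. \<Sum>k<d. (u k i)\<^sup>2)"
    by (rule sum.swap)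
  also have "\<dots> \<le> (\<Sum>i\<in>T. B)"
    using diag by (intro sum_mono)
  finally show ?thesis
    using True by (simp add: d_def mult.commute)
qed

lemma heavy_hitter_free_bound:
  assumes "x \<in> carrier_vec n" "T \<subseteq> {..<n}" "\<And>i. i < n \<Longrightarrow> i \<notin> T \<Longrightarrow> x $ i = 0"
    and "heavy_hitters \<epsilon> x \<inter> T = {}" "i \<in> T"
  shows "(x $ i)\<^sup>2 \<le> \<epsilon>\<^sup>2 * real (card T) * (\<Sum>j\<in>T. (x $ j)\<^sup>2)"
proof -
  have l1: "l1_norm x = (\<Sum>j\<in>T. \<bar>x $ j\<bar>)"
    unfolding l1_norm_def using assms(1-3) by (intro sum.mono_neutral_right) auto
  have "\<bar>x $ i\<bar> < \<epsilon> * l1_norm x"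
    using assms(1,2,4,5) by (force simp: heavy_hitters_def)
  then have "\<bar>x $ i\<bar>\<^sup>2 \<le> (\<epsilon> * l1_norm x)\<^sup>2"
    by (intro power_mono) auto
  also have "\<dots> = \<epsilon>\<^sup>2 * (\<Sum>j\<in>T. \<bar>x $ j\<bar>)\<^sup>2"
    by (simp add: l1 power_mult_distrib)
  also have "\<dots> \<le> \<epsilon>\<^sup>2 * (real (card T) * (\<Sum>j\<in>T. \<bar>x $ j\<bar>\<^sup>2))"
    using sum_squared_le_sum_of_squares[of "\<lambda>j. \<bar>x $ j\<bar>" T]
    by (intro mult_left_mono) (auto simp: mult.commute)
  finally show ?thesis by (simp add: mult.assoc)
qed

text \<open>Vectors in the kernel of \<open>S\<close> share the sketch of zero, so those supported
  on \<open>T\<close> have no heavy hitters in \<open>T\<close> and are spread with \<open>B\<close>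
  equal to \<open>\<epsilon>\<^sup>2 * card T\<close>.\<close>

lemma heavy_hitters_rows_bound:
  assumes S: "S \<in> carrier_mat m n" and alg: "finds_heavy_hitters \<epsilon> k S alg"
    and "T \<subseteq> {..<n} - alg (0\<^sub>v m)"
  shows "real (card T) - real m \<le> \<epsilon>\<^sup>2 * real (card T) * real (card T)"
proof (rule kernel_spread_bound[where a = "\<lambda>j i. S $$ (j, i)"])
  have T: "T \<subseteq> {..<n}" using assms(3) by auto
  then show "finite T" by (rule finite_subset) simp
  show "\<epsilon>\<^sup>2 * real (card T) \<ge> 0" by simp
  fix y i
  assume ker: "\<And>j. j < m \<Longrightarrow> (\<Sum>i\<in>T. S $$ (j, i) * y i) = 0" and i: "i \<in> T"
  define x where "x = vec n (\<lambda>i. if i \<in> T then y i else 0)"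
  have x: "x \<in> carrier_vec n" "\<And>i. i \<in> T \<Longrightarrow> x $ i = y i" "\<And>i. i < n \<Longrightarrow> i \<notin> T \<Longrightarrow> x $ i = 0"
    using T by (auto simp: x_def)
  have Sx: "S *\<^sub>v x = 0\<^sub>v m"
  proof (rule eq_vecI)
    fix j assume "j < dim_vec (0\<^sub>v m :: real vec)"
    then have j: "j < m" by simp
    have "(S *\<^sub>v x) $ j = (\<Sum>i<n. S $$ (j, i) * x $ i)"
      using S x(1) j by (auto simp: scalar_prod_def lessThan_atLeast0)
    also have "\<dots> = (\<Sum>i\<in>T. S $$ (j, i) * y i)"
      using T x by (intro sum.mono_neutral_cong_right) auto
    finally show "(S *\<^sub>v x) $ j = 0\<^sub>v m $ j" using ker j by simp
  qed (use S in auto)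
  show "(y i)\<^sup>2 \<le> \<epsilon>\<^sup>2 * real (card T) * (\<Sum>i\<in>T. (y i)\<^sup>2)"
  \<comment> \<open>The correctness guarantee exempts the zero vector, for which the bound is
    trivial.\<close>
  proof (cases "x = 0\<^sub>v n")
    case True
    then have "y i = 0" using x(2)[OF i] T i by auto
    then show ?thesis by (simp add: sum_nonneg)
  next
    case False
    then have "heavy_hitters \<epsilon> x \<subseteq> alg (0\<^sub>v m)"
      using alg S x(1) unfolding finds_heavy_hitters_def by (metis Sx carrier_matD(2))
    then have "heavy_hitters \<epsilon> x \<inter> T = {}" using assms(3) by auto
    from heavy_hitter_free_bound[OF x(1) T x(3) this i]
    show ?thesis using x(2) i by simp
  qed
qed

theorem theorem5:
  fixes c C :: real
  assumes "c > 0" and "C > 0"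
  shows "\<exists>c' > 0. \<exists>\<epsilon>\<^sub>0 > 0. \<forall>(\<epsilon>::real) (n::nat) (m::nat) (S::real mat).
           0 < \<epsilon> \<longrightarrow> \<epsilon> \<le> \<epsilon>\<^sub>0 \<longrightarrow> real n \<ge> c / \<epsilon>\<^sup>2 \<longrightarrow> S \<in> carrier_mat m n \<longrightarrow>
           (\<exists>alg. finds_heavy_hitters \<epsilon> (C / \<epsilon>) S alg) \<longrightarrow>
           real m \<ge> c' / \<epsilon>\<^sup>2"
proof -
  \<comment> \<open>The bound by \<open>c\<close> lets \<open>T\<close> fit into the
    \<open>n\<close> indices; the bound by 1/2 gives
    \<open>\<epsilon>\<^sup>2 * card T \<le> 1/2\<close>.\<close>
  define c\<^sub>0 where "c\<^sub>0 = min c (1/2)"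
  have c0: "c\<^sub>0 > 0" "c\<^sub>0 \<le> c" "c\<^sub>0 \<le> 1/2" using assms by (auto simp: c\<^sub>0_def)
  \<comment> \<open>Chosen so that rounding down and removing \<open>A\<close> cost at most half of
    \<open>c\<^sub>0 / \<epsilon>\<^sup>2\<close>; the spread bound costs another factor 2, whence
    \<open>c\<^sub>0 / 4\<close>.\<close>
  define \<epsilon>\<^sub>0 where "\<epsilon>\<^sub>0 = min 1 (c\<^sub>0 / (2 * (C + 1)))"
  have main: "real m \<ge> (c\<^sub>0 / 4) / \<epsilon>\<^sup>2"
    if e: "0 < \<epsilon>" "\<epsilon> \<le> \<epsilon>\<^sub>0" and n: "real n \<ge> c / \<epsilon>\<^sup>2" and S: "S \<in> carrier_mat m n"
      and alg: "finds_heavy_hitters \<epsilon> (C / \<epsilon>) S alg" for \<epsilon> n m S alg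
  proof -
    define A where "A = alg (0\<^sub>v m)"
    \<comment> \<open>The size bound on the output holds for the zero vector too; only containment
      is exempted there.\<close>
    have "S *\<^sub>v 0\<^sub>v n = 0\<^sub>v m" using S by auto
    then have A: "A \<subseteq> {..<n}" "real (card A) \<le> C / \<epsilon>"
      using alg S unfolding finds_heavy_hitters_def A_def
      by (metis carrier_matD(2) zero_carrier_vec)+
    have finA: "finite A" using A(1) by (rule finite_subset) simp
    define N where "N = nat \<lfloor>c\<^sub>0 / \<epsilon>\<^sup>2\<rfloor>"
    have "c\<^sub>0 / \<epsilon>\<^sup>2 \<ge> 0" using c0 by simp
    then have N: "real N \<le> c\<^sub>0 / \<epsilon>\<^sup>2" "real N \<ge> c\<^sub>0 / \<epsilon>\<^sup>2 - 1"
      unfolding N_def by linarith+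
    have "c\<^sub>0 / \<epsilon>\<^sup>2 \<le> c / \<epsilon>\<^sup>2" using c0 by (intro divide_right_mono) auto
    then have "N \<le> n" using N n by linarith
    define T where "T = {..<N} - A"
    have "card T \<le> N" "card T \<ge> N - card A"
      using card_mono[of "{..<N}" T] diff_card_le_card_Diff[of A "{..<N}"] finA
      by (auto simp: T_def)
    then have T: "real (card T) \<le> c\<^sub>0 / \<epsilon>\<^sup>2" "real (card T) \<ge> c\<^sub>0 / \<epsilon>\<^sup>2 - 1 - C / \<epsilon>"
      using N A by linarith+
    have "T \<subseteq> {..<n} - alg (0\<^sub>v m)" using \<open>N \<le> n\<close> by (auto simp: T_def A_def)
    then have "real (card T) - real m \<le> \<epsilon>\<^sup>2 * real (card T) * real (card T)"
      using heavy_hitters_rows_bound[OF S alg] by simp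
    also have "\<dots> \<le> 1/2 * real (card T)"
      using T(1) c0 e by (intro mult_right_mono) (auto simp: field_simps)
    finally have m: "real m \<ge> real (card T) / 2" by simp
    have "1 + C / \<epsilon> \<le> c\<^sub>0 / 2 / \<epsilon>\<^sup>2"
    proof -
      have "\<epsilon>\<^sup>2 + C * \<epsilon> \<le> (C + 1) * \<epsilon>"
        using e by (simp add: \<epsilon>\<^sub>0_def power2_eq_square algebra_simps)
      also have "(C + 1) * \<epsilon> \<le> c\<^sub>0 / 2"
        using e assms by (auto simp: \<epsilon>\<^sub>0_def field_simps)
      finally have "(\<epsilon>\<^sup>2 + C * \<epsilon>) / \<epsilon>\<^sup>2 \<le> c\<^sub>0 / 2 / \<epsilon>\<^sup>2"
        by (rule divide_right_mono) simp
      then show ?thesis using e by (simp add: add_divide_distrib power2_eq_square)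
    qed
    then show ?thesis using m T(2) by simp
  qed
  have "\<epsilon>\<^sub>0 > 0" "c\<^sub>0 / 4 > 0" using c0 assms by (auto simp: \<epsilon>\<^sub>0_def)
  with main show ?thesis by blast
qed

end
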